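(* Let $r$ and $n$ be positive integers and let $G$ be a graph with $n$ vertices and maximum degree $\Delta(G)\le r$. Write $n=a(r+1)+b$ with integers $a\ge 0$ and $0\le b\le r$. Then: (1) for every integer $t\ge 3$ there exist an integer $a'\ge 0$ and a graph $H$ with $n(H)\le 2r(r+1)/(3\sqrt{3})$ such that $n=a'(r+1)+n(H)$ and $k_t(G)\le k_t(a'K_{r+1}\cup H)$; (2) if $r\le 6$, then $k_3(G)\le k_3(aK_{r+1}\cup K_b)$.
   Context: For a graph $G$, $k_t(G)$ denotes the number of complete subgraphs (cliques) of $G$ on exactly $t$ vertices, and $n(H)$ denotes the number of vertices of $H$. $aK_{r+1}\cup K_b$ denotes the disjoint union of $a$ copies of the complete graph $K_{r+1}$ and one copy of $K_b$ (with $K_0$ the empty graph).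
   Formalization: Part (1) is stated except when r = 1 and n is odd; there it is false, since the bound 2r(r+1)/(3√3) < 1 forces n(H) = 0, so n = 2a' would be even (e.g. G = K_1, r = n = 1). *)

theory Defs
  imports Complex_Main "HOL-Library.Ramsey"
begin

text \<open>
  A graph is a pair of a vertex set and a set of edges, an edge being a two-element set of
  vertices. The notation \<open>[V]\<^bsup>k\<^esup>\<close> stands for the set of \<open>k\<close>-element subsets of \<open>V\<close>.
\<close>

type_synonym 'a graph = "'a set \<times> 'a set set"

abbreviation verts :: "'a graph \<Rightarrow> 'a set" where
  "verts G \<equiv> fst G"

abbreviation edges :: "'a graph \<Rightarrow> 'a set set" where
  "edges G \<equiv> snd G"

definition simple_graph :: "'a graph \<Rightarrow> bool" where
  "simple_graph G \<longleftrightarrow> finite (verts G) \<and> edges G \<subseteq> [verts G]\<^bsup>2\<^esup>"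

definition num_verts :: "'a graph \<Rightarrow> nat" where
  "num_verts G = card (verts G)"

definition vertex_degree :: "'a graph \<Rightarrow> 'a \<Rightarrow> nat" where
  "vertex_degree G v = card {w \<in> verts G. {v, w} \<in> edges G}"

text \<open>Only meaningful for graphs with at least one vertex, as \<open>Max {}\<close> is unspecified.\<close>

definition max_degree :: "'a graph \<Rightarrow> nat" where
  "max_degree G = Max (vertex_degree G ` verts G)"

definition num_cliques :: "nat \<Rightarrow> 'a graph \<Rightarrow> nat" where
  "num_cliques t G = card {S \<in> [verts G]\<^bsup>t\<^esup>. clique S (edges G)}"

definition complete_graph :: "nat \<Rightarrow> nat graph" where
  "complete_graph m = ({..<m}, [{..<m}]\<^bsup>2\<^esup>)"

definition disjoint_union :: "'a graph \<Rightarrow> 'b graph \<Rightarrow> ('a + 'b) graph" where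
  "disjoint_union G H =
     (verts G <+> verts H, (image Inl ` edges G) \<union> (image Inr ` edges H))"

text \<open>The disjoint union of \<open>a\<close> copies of a graph; the first component numbers the copies.\<close>

definition copies :: "nat \<Rightarrow> 'a graph \<Rightarrow> (nat \<times> 'a) graph" where
  "copies a G = ({..<a} \<times> verts G, \<Union>i<a. image (Pair i) ` edges G)"

text \<open>
  For \<open>r = 1\<close> a graph with at most \<open>2 * r * (r + 1) / (3 * sqrt 3)\<close> vertices is empty, so that
  no odd \<open>n\<close> can be written as \<open>a' * (r + 1) + num_verts H\<close> with \<open>H\<close> of that size.
\<close>

lemma no_decomposition_odd:
  fixes a' h n :: nat
  assumes "odd n" "real h \<le> 2 * real 1 * (real 1 + 1) / (3 * sqrt 3)"
  shows "n \<noteq> a' * (1 + 1) + h"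
proof -
  have "2 * real 1 * (real 1 + 1) < 3 * sqrt 3"
    by (rule power2_less_imp_less) (auto simp: power_mult_distrib)
  then have "2 * real 1 * (real 1 + 1) / (3 * sqrt 3) < 1"
    by simp
  with assms(2) have "h = 0"
    by linarith
  with assms(1) show ?thesis
    by auto
qed

end

theory Submission
  imports Defs
begin

text \<open>
  The bound \<open>k\<^sub>t(G) \<le> k\<^sub>t(aK\<^sub>r\<^sub>+\<^sub>1 \<union> K\<^sub>b)\<close> holds for every \<open>r\<close> and every \<open>t \<ge> 3\<close>, by Chase's argument: some
  closed neighbourhood \<open>N[v]\<close> meets at most \<open>|N[v]| choose t\<close> cliques of size \<open>t\<close>, so that
  one can delete it and induct, using the convexity of binomial coefficients. To find \<open>v\<close>,
  compare the pairs \<open>(z, T)\<close> of a vertex \<open>z\<close> and a \<open>t\<close>-clique \<open>T\<close> meeting \<open>N[z]\<close> with the pairs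
  \<open>(z, S)\<close> of a vertex \<open>z\<close> and a \<open>t\<close>-subset \<open>S\<close> of \<open>N[z]\<close>. They agree when \<open>T \<subseteq> N[z]\<close> and \<open>S\<close> is
  a clique. Any other \<open>(z, T)\<close> is charged to \<open>(u, X - {u})\<close> with \<open>X = T \<union> {z}\<close> and \<open>u \<in> T\<close> a
  neighbour of \<open>z\<close>, hence of all of \<open>X - {u}\<close>. Given \<open>X\<close>, the vertex \<open>z\<close> is unique unless \<open>X\<close> is a
  clique minus an edge; then there are two such \<open>z\<close>, but also \<open>t - 1 \<ge> 2\<close> choices of \<open>u\<close>.
\<close>

section \<open>Cliques and closed neighbourhoods\<close>

text \<open>\<open>V\<close> and \<open>E\<close> are separate arguments so that the later induction
  can shrink \<open>V\<close> and keep \<open>E\<close> fixed; edges leaving \<open>V\<close> are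
  then ignored.\<close>

definition cliques :: "nat \<Rightarrow> 'a set \<Rightarrow> 'a set set \<Rightarrow> 'a set set" where
  "cliques t V E = {S \<in> [V]\<^bsup>t\<^esup>. clique S E}"

definition closed_nbhd :: "'a set \<Rightarrow> 'a set set \<Rightarrow> 'a \<Rightarrow> 'a set" where
  "closed_nbhd V E v = {w \<in> V. w = v \<or> {v, w} \<in> E}"

lemma num_cliques_eq: "num_cliques t G = card (cliques t (verts G) (edges G))"
  by (simp add: num_cliques_def cliques_def)

lemma closed_nbhd_subset: "closed_nbhd V E v \<subseteq> V"
  by (auto simp: closed_nbhd_def)

lemma finite_cliques: "finite V \<Longrightarrow> finite (cliques t V E)"
  by (simp add: cliques_def finite_imp_finite_nsets)

lemma cliquesD:
  assumes "S \<in> cliques t V E"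
  shows "S \<subseteq> V" "finite S" "card S = t" "clique S E"
  using assms by (auto simp: cliques_def nsets_def)

lemma cliques_nonempty: "S \<in> cliques t V E \<Longrightarrow> t > 0 \<Longrightarrow> S \<noteq> {}"
  by (auto simp: cliques_def nsets_def)

lemma clique_subset_closed_nbhd:
  assumes "clique T E" "T \<subseteq> V" "z \<in> T"
  shows "T \<subseteq> closed_nbhd V E z"
  using assms by (auto simp: clique_def closed_nbhd_def)

section \<open>The charging argument\<close>

text \<open>This is the charging for one fixed \<open>X\<close>: the left side counts the
  \<open>z\<close> whose pair \<open>(z, X - {z})\<close> must be charged, the right side the
  \<open>u\<close> whose pair \<open>(u, X - {u})\<close> can receive a charge.\<close>

lemma card_near_clique_vertices_le_dominating:
  assumes X: "X \<subseteq> V" "finite X" "card X = Suc t" and t: "t \<ge> 3"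
  shows "card {z \<in> X. clique (X - {z}) E \<and> closed_nbhd V E z \<inter> (X - {z}) \<noteq> {}
                      \<and> \<not> X \<subseteq> closed_nbhd V E z}
         \<le> card {u \<in> X. X \<subseteq> closed_nbhd V E u \<and> \<not> clique (X - {u}) E}"
    (is "card ?A \<le> card ?B")
proof (cases "?A = {}")
  case True
  then show ?thesis by (metis card.empty le0)
next
  case False
  then obtain z where z: "z \<in> ?A" by blast
  \<comment> \<open>Every neighbour \<open>u\<close> of \<open>z\<close> in \<open>X\<close> can
    receive a charge: \<open>u\<close> lies in the clique \<open>X - {z}\<close>, hence dominates
    \<open>X\<close>; if \<open>X - {u}\<close> were a clique as well, \<open>z\<close> would
    dominate \<open>X\<close>.\<close>
  have dom: "u \<in> ?B" if "u \<in> X" "u \<noteq> z" "{z, u} \<in> E" for u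
  proof -
    have "X \<subseteq> closed_nbhd V E u"
      using z that X(1) by (auto simp: clique_def closed_nbhd_def insert_commute)
    moreover have "\<not> clique (X - {u}) E"
    proof
      assume "clique (X - {u}) E"
      then have "{z, x} \<in> E" if "x \<in> X" "x \<noteq> z" for x
        using z \<open>u \<noteq> z\<close> \<open>{z, u} \<in> E\<close> that unfolding clique_def
        by (cases "x = u") auto
      then have "X \<subseteq> closed_nbhd V E z"
        using X(1) by (auto simp: closed_nbhd_def)
      then show False using z by blast
    qed
    ultimately show ?thesis using that by blast
  qed
  have finB: "finite ?B" using X(2) by simp
  show ?thesis
  proof (cases "?A = {z}")
    case True
    obtain u where "u \<in> X" "u \<noteq> z" "{z, u} \<in> E"
      using z by (auto simp: closed_nbhd_def)
    then have "?B \<noteq> {}" using dom by blast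
    then have "card ?B > 0" using finB by (intro card_gt_0_iff[THEN iffD2] conjI)
    moreover have "card ?A = 1" using True by (metis card_1_singleton_iff One_nat_def)
    ultimately show ?thesis by simp
  next
    case False
    \<comment> \<open>With two such vertices, \<open>X\<close> is a clique minus the edge between
      \<open>z\<close> and \<open>w\<close>. All of \<open>X - {z, w}\<close> then dominates
      \<open>X\<close>, and a third member of \<open>?A\<close> would force the missing
      edge.\<close>
    then obtain w where w: "w \<in> ?A" "w \<noteq> z" using z by blast
    have adj: "{z, u} \<in> E" if "u \<in> X" "u \<noteq> z" "u \<noteq> w" for u
      using w z that by (auto simp: clique_def)
    have nadj: "{z, w} \<notin> E"
      using z X(1) adj by (auto simp: closed_nbhd_def)
    have "?A \<subseteq> {z, w}"
    proof
      fix v assume v: "v \<in> ?A"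
      show "v \<in> {z, w}"
      proof (rule ccontr)
        assume "v \<notin> {z, w}"
        then have "{z, w} \<in> E" using v w z by (auto simp: clique_def)
        then show False using nadj by blast
      qed
    qed
    then have "card ?A \<le> card {z, w}" by (rule card_mono[rotated]) simp
    also have "\<dots> = 2" using w by simp
    \<comment> \<open>The set has \<open>t - 1\<close> elements, so this is where
      \<open>t \<ge> 3\<close> enters.\<close>
    also have "2 \<le> card (X - {z, w})"
      using X t w z by (simp add: card_Diff_subset)
    also have "\<dots> \<le> card ?B"
      using finB dom adj by (intro card_mono) auto
    finally show ?thesis .
  qed
qed

text \<open>The inequality is summed over \<open>V\<close> because it can fail at a single vertex,
  for instance at a pendant vertex attached to a triangle when \<open>t = 3\<close>.\<close>

lemma sum_cliques_meeting_closed_nbhd_le: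
  assumes V: "finite V" and t: "t \<ge> 3"
  shows "(\<Sum>v\<in>V. card {T \<in> cliques t V E. closed_nbhd V E v \<inter> T \<noteq> {}})
         \<le> (\<Sum>v\<in>V. card (closed_nbhd V E v) choose t)"
proof -
  let ?N = "closed_nbhd V E"
  define P where "P = Sigma V (\<lambda>v. {T \<in> cliques t V E. ?N v \<inter> T \<noteq> {}})"
  define Q where "Q = Sigma V (\<lambda>v. [?N v]\<^bsup>t\<^esup>)"
  define P1 where "P1 = {(z, T) \<in> P. T \<subseteq> ?N z}"
  define Q1 where "Q1 = {(z, S) \<in> Q. clique S E}"
  define A where "A = (\<lambda>X. {z \<in> X. clique (X - {z}) E \<and> ?N z \<inter> (X - {z}) \<noteq> {} \<and> \<not> X \<subseteq> ?N z})"
  define B where "B = (\<lambda>X. {u \<in> X. X \<subseteq> ?N u \<and> \<not> clique (X - {u}) E})"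
  \<comment> \<open>Turns a set with a marked vertex into a pair of the kind found in
    \<open>P\<close> and \<open>Q\<close>: the marked vertex is \<open>z\<close> for
    \<open>A\<close> and \<open>u\<close> for \<open>B\<close>. It is injective when the vertex lies
    in \<open>X\<close>, since \<open>X\<close> is regained by inserting it.\<close>
  define split where "split = (\<lambda>(X :: 'a set, z). (z, X - {z}))"
  have finN: "finite (?N v)" for v
    using V closed_nbhd_subset finite_subset by metis
  have finP: "finite P" and finQ: "finite Q"
    using V finN by (auto simp: P_def Q_def finite_cliques intro!: finite_imp_finite_nsets)
  have cP: "card P = (\<Sum>v\<in>V. card {T \<in> cliques t V E. ?N v \<inter> T \<noteq> {}})"
    using V by (simp add: P_def finite_cliques)
  have cQ: "card Q = (\<Sum>v\<in>V. card (?N v) choose t)"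
    using V finN by (simp add: Q_def finite_imp_finite_nsets card_nsets)
  have "P1 = Q1"
  proof (intro equalityI subsetI)
    fix x assume "x \<in> P1"
    then show "x \<in> Q1"
      by (auto simp: P1_def Q1_def P_def Q_def cliques_def nsets_def)
  next
    fix x assume x: "x \<in> Q1"
    obtain z S where zS: "x = (z, S)" by fastforce
    then have "S \<subseteq> ?N z" "finite S" "card S = t" "clique S E" "z \<in> V"
      using x by (auto simp: Q1_def Q_def nsets_def)
    moreover from this have "S \<noteq> {}" "S \<subseteq> V"
      using t closed_nbhd_subset[of V E z] by auto
    ultimately show "x \<in> P1"
      using zS by (auto simp: P1_def P_def cliques_def nsets_def)
  qed
  have inj: "inj_on split (Sigma ([V]\<^bsup>Suc t\<^esup>) F)" if "\<And>X. F X \<subseteq> X" for F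
  proof (rule inj_onI)
    fix p q assume "p \<in> Sigma ([V]\<^bsup>Suc t\<^esup>) F" "q \<in> Sigma ([V]\<^bsup>Suc t\<^esup>) F" and eq: "split p = split q"
    then have "snd p \<in> fst p" "snd q \<in> fst q"
      by (auto dest: subsetD[OF that])
    with eq show "p = q"
      by (auto simp: split_def split: prod.splits)
  qed
  have finS: "finite ([V]\<^bsup>Suc t\<^esup>)" using V by (rule finite_imp_finite_nsets)
  have finF: "finite (A X)" "finite (B X)" if "X \<in> [V]\<^bsup>Suc t\<^esup>" for X
    using that by (auto simp: A_def B_def nsets_def)
  have finSA: "finite (Sigma ([V]\<^bsup>Suc t\<^esup>) A)"
    using finS finF by blast
  have "P - P1 \<subseteq> split ` Sigma ([V]\<^bsup>Suc t\<^esup>) A"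
  proof
    fix x assume x: "x \<in> P - P1"
    obtain z T where zT: "x = (z, T)" by fastforce
    have T: "T \<in> cliques t V E" "z \<in> V" "?N z \<inter> T \<noteq> {}" "\<not> T \<subseteq> ?N z"
      using x zT by (auto simp: P_def P1_def)
    \<comment> \<open>A clique containing \<open>z\<close> lies inside the closed neighbourhood of
      \<open>z\<close>, so its pair would belong to \<open>P1\<close>.\<close>
    have "z \<notin> T"
      using T clique_subset_closed_nbhd cliquesD by metis
    then have "insert z T - {z} = T" by blast
    then have "z \<in> A (insert z T)"
      using T cliquesD(4)[OF T(1)] by (auto simp: A_def)
    moreover have "insert z T \<in> [V]\<^bsup>Suc t\<^esup>"
      using T(2) \<open>z \<notin> T\<close> cliquesD[OF T(1)] by (auto simp: nsets_def)
    moreover have "split (insert z T, z) = x"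
      using zT \<open>insert z T - {z} = T\<close> by (simp add: split_def)
    ultimately show "x \<in> split ` Sigma ([V]\<^bsup>Suc t\<^esup>) A" by (metis SigmaI image_eqI)
  qed
  then have "card (P - P1) \<le> card (Sigma ([V]\<^bsup>Suc t\<^esup>) A)"
    using finSA by (meson card_image_le card_mono finite_imageI le_trans)
  also have "\<dots> = (\<Sum>X\<in>[V]\<^bsup>Suc t\<^esup>. card (A X))"
    using finS finF by simp
  also have "\<dots> \<le> (\<Sum>X\<in>[V]\<^bsup>Suc t\<^esup>. card (B X))"
    unfolding A_def B_def using t
    by (intro sum_mono card_near_clique_vertices_le_dominating) (auto simp: nsets_def)
  also have "\<dots> = card (Sigma ([V]\<^bsup>Suc t\<^esup>) B)"
    using finS finF by simp
  also have "\<dots> = card (split ` Sigma ([V]\<^bsup>Suc t\<^esup>) B)"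
    by (rule card_image[symmetric], rule inj) (auto simp: B_def)
  also have "\<dots> \<le> card (Q - Q1)"
  proof (rule card_mono)
    show "split ` Sigma ([V]\<^bsup>Suc t\<^esup>) B \<subseteq> Q - Q1"
      by (auto simp: split_def B_def Q_def Q1_def nsets_def)
  qed (use finQ in simp)
  finally have "card (P - P1) \<le> card (Q - Q1)" .
  moreover have "P1 \<subseteq> P" "Q1 \<subseteq> Q" by (auto simp: P1_def Q1_def)
  ultimately have "card P \<le> card Q"
    using finP finQ \<open>P1 = Q1\<close> by (metis card_Diff_subset card_mono diff_le_mono2 finite_subset
        le_diff_conv le_add_diff_inverse2)
  then show ?thesis using cP cQ by simp
qed

section \<open>Deleting a closed neighbourhood\<close>

text \<open>Convexity of \<open>x choose t\<close> in \<open>x\<close>: by Pascal's rule a unit step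
  from \<open>x\<close> adds \<open>x choose (t - 1)\<close>, which grows with
  \<open>x\<close>.\<close>

lemma binomial_shift_convex:
  assumes "c \<le> y" "t > 0"
  shows "((c + k) choose t) + (y choose t) \<le> ((y + k) choose t) + (c choose t)"
proof (induction k)
  case (Suc k)
  obtain s where s: "t = Suc s" using assms by (cases t) auto
  have "(c + k) choose s \<le> (y + k) choose s"
    using assms by (intro binomial_right_mono) simp
  with Suc show ?case by (simp add: s)
qed simp

text \<open>Strong induction on \<open>card V\<close>, deleting a suitable \<open>?N v\<close>. The
  degree condition is put as a bound on closed neighbourhoods, which passes to subsets of
  \<open>V\<close> and makes sense for the empty set.\<close>

lemma card_cliques_le:
  assumes "finite V" "t \<ge> 3" "\<And>v. v \<in> V \<Longrightarrow> card (closed_nbhd V E v) \<le> r + 1"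
    and "card V = a * (r + 1) + b" "b \<le> r"
  shows "card (cliques t V E) \<le> a * ((r + 1) choose t) + (b choose t)"
  using assms
proof (induction "card V" arbitrary: V a b rule: less_induct)
  case less
  show ?case
  proof (cases "V = {}")
    case True
    then have "cliques t V E = {}"
      using less.prems(2) by (auto simp: cliques_def nsets_def)
    then show ?thesis by simp
  next
    case False
    let ?N = "closed_nbhd V E"
    let ?M = "\<lambda>v. {T \<in> cliques t V E. ?N v \<inter> T \<noteq> {}}"
    \<comment> \<open>Averaging: if every vertex violated the bound, the sums would compare strictly
      the wrong way.\<close>
    obtain v where v: "v \<in> V" "card (?M v) \<le> card (?N v) choose t"
      using sum_cliques_meeting_closed_nbhd_le[OF less.prems(1,2), of E] False
        sum_strict_mono[OF less.prems(1) False] by (metis (mono_tags, lifting) leD leI)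
    define s where "s = card (?N v)"
    define W where "W = V - ?N v"
    have finN: "finite (?N v)"
      using less.prems(1) closed_nbhd_subset finite_subset by metis
    have "v \<in> ?N v" using v by (simp add: closed_nbhd_def)
    then have s: "s > 0" "s \<le> r + 1"
      using finN v less.prems(3) by (auto simp: s_def card_gt_0_iff)
    have cW: "card V = card W + s"
      using card_Diff_subset[OF finN closed_nbhd_subset] card_mono[OF less.prems(1) closed_nbhd_subset]
      by (simp add: W_def s_def)
    have "cliques t V E = cliques t W E \<union> ?M v"
      by (auto simp: cliques_def nsets_def W_def)
    then have "card (cliques t V E) \<le> card (cliques t W E) + card (?M v)"
      by (metis card_Un_le)
    also have "\<dots> \<le> card (cliques t W E) + (s choose t)"
      using v by (simp add: s_def)
    finally have le: "card (cliques t V E) \<le> card (cliques t W E) + (s choose t)" .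
    have IH: "card (cliques t W E) \<le> a' * ((r + 1) choose t) + (b' choose t)"
      if "card W = a' * (r + 1) + b'" "b' \<le> r" for a' b'
    proof (rule less.hyps[OF _ _ less.prems(2) _ that])
      show "card W < card V" using cW s by simp
      show "finite W" using less.prems(1) by (simp add: W_def)
      fix w assume w: "w \<in> W"
      have "card (closed_nbhd W E w) \<le> card (?N w)"
        using less.prems(1) by (intro card_mono) (auto simp: closed_nbhd_def W_def)
      also have "\<dots> \<le> r + 1" using w less.prems(3) by (simp add: W_def)
      finally show "card (closed_nbhd W E w) \<le> r + 1" .
    qed
    show ?thesis
    proof (cases "s \<le> b")
      case True
      \<comment> \<open>The deleted vertices fit into the remainder, which drops to
        \<open>b - s\<close>; convexity from \<open>0\<close> merges the two binomials into
        \<open>b choose t\<close>.\<close>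
      have "card (cliques t W E) \<le> a * ((r + 1) choose t) + ((b - s) choose t)"
        using True cW less.prems(4,5) by (intro IH) auto
      moreover have "(s choose t) + ((b - s) choose t) \<le> b choose t"
        using binomial_shift_convex[of 0 "b - s" t s] binomial_eq_0[of 0 t] True less.prems(2) by simp
      ultimately show ?thesis using le by simp
    next
      case False
      then obtain a' where a': "a = Suc a'"
        using cW less.prems(4) by (cases a) auto
      \<comment> \<open>One block of \<open>r + 1\<close> vertices is broken up, and
        \<open>b < s\<close> keeps \<open>b' \<le> r\<close>. Shifting \<open>b\<close> and
        \<open>s\<close> by \<open>r + 1 - s\<close> gives \<open>b'\<close> and
        \<open>r + 1\<close>, so convexity restores the full block.\<close>
      define b' where "b' = b + (r + 1 - s)"
      have "card (cliques t W E) \<le> a' * ((r + 1) choose t) + (b' choose t)"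
        using False cW less.prems(4,5) s a' by (intro IH) (auto simp: b'_def)
      moreover have "(b' choose t) + (s choose t) \<le> ((r + 1) choose t) + (b choose t)"
        using binomial_shift_convex[of b s t "r + 1 - s"] False s less.prems(2) by (simp add: b'_def)
      ultimately show ?thesis using le a' by simp
    qed
  qed
qed

section \<open>Cliques in disjoint unions\<close>

lemma num_cliques_complete_graph: "num_cliques t (complete_graph m) = m choose t"
proof -
  have "{S \<in> [{..<m}]\<^bsup>t\<^esup>. clique S ([{..<m}]\<^bsup>2\<^esup>)} = [{..<m}]\<^bsup>t\<^esup>"
    by (auto simp: nsets_def clique_def subset_eq)
  then show ?thesis by (simp add: num_cliques_def complete_graph_def card_nsets)
qed

lemma clique_image:
  assumes "clique S E" "image f ` E \<subseteq> F"
  shows "clique (f ` S) F"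
proof -
  have "{f x, f y} \<in> F" if "x \<in> S" "y \<in> S" "f x \<noteq> f y" for x y
  proof -
    have "f ` {x, y} \<in> image f ` E"
      using that assms(1) by (intro imageI) (auto simp: clique_def)
    then show ?thesis using assms(2) by auto
  qed
  then show ?thesis by (auto simp: clique_def)
qed

lemma image_cliques_subset:
  assumes "inj f" "f ` V \<subseteq> W" "image f ` E \<subseteq> F"
  shows "image f ` cliques t V E \<subseteq> cliques t W F"
proof
  fix U assume "U \<in> image f ` cliques t V E"
  then obtain S where "U = f ` S" "S \<in> cliques t V E" by blast
  with assms show "U \<in> cliques t W F"
    using clique_image[of S E f F] card_image[OF inj_on_subset[OF assms(1) subset_UNIV], of S]
    by (auto 0 3 simp: cliques_def nsets_def)
qed

text \<open>A lower bound suffices, since the union stands on the larger side of the theorem.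
  \<open>Inl\<close> and \<open>Inr\<close> preserve cliques, and \<open>t > 0\<close> excludes the
  empty clique, which both images would share.\<close>

lemma num_cliques_disjoint_union_ge:
  fixes G :: "'a graph" and H :: "'b graph"
  assumes "finite (verts G)" "finite (verts H)" "t > 0"
  shows "num_cliques t G + num_cliques t H \<le> num_cliques t (disjoint_union G H)"
proof -
  let ?D = "disjoint_union G H"
  let ?L = "image (Inl :: _ \<Rightarrow> 'a + 'b) ` cliques t (verts G) (edges G)"
  let ?R = "image (Inr :: _ \<Rightarrow> 'a + 'b) ` cliques t (verts H) (edges H)"
  have "?L \<subseteq> cliques t (verts ?D) (edges ?D)" "?R \<subseteq> cliques t (verts ?D) (edges ?D)"
    by (rule image_cliques_subset; auto simp: disjoint_union_def)+
  then have "card (?L \<union> ?R) \<le> card (cliques t (verts ?D) (edges ?D))"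
    using assms by (intro card_mono finite_cliques) (auto simp: disjoint_union_def)
  moreover have "?L \<inter> ?R = {}"
  proof -
    have "Inl ` S \<noteq> Inr ` T" if "S \<in> cliques t (verts G) (edges G)" for S T
      using cliques_nonempty[OF that assms(3)] by blast
    then show ?thesis by blast
  qed
  moreover have "card ?L = num_cliques t G" "card ?R = num_cliques t H"
    by (simp_all add: card_image inj_on_def inj_image_eq_iff num_cliques_eq)
  ultimately show ?thesis
    using assms by (simp add: card_Un_disjoint finite_cliques num_cliques_eq)
qed

lemma num_cliques_copies_ge:
  assumes "finite (verts G)" "t > 0"
  shows "a * num_cliques t G \<le> num_cliques t (copies a G)"
proof -
  let ?C = "cliques t (verts G) (edges G)"
  let ?D = "cliques t (verts (copies a G)) (edges (copies a G))"
  let ?f = "\<lambda>i :: nat. image (image (Pair i)) ?C"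
  have "?f i \<subseteq> ?D" if "i < a" for i
    using that by (intro image_cliques_subset) (auto simp: copies_def inj_on_def)
  then have "card (\<Union>i<a. ?f i) \<le> card ?D"
    using assms by (intro card_mono finite_cliques) (auto simp: copies_def)
  moreover have "card (\<Union>i<a. ?f i) = (\<Sum>i<a. card (?f i))"
  proof (rule card_UN_disjoint)
    show "\<forall>i\<in>{..<a}. \<forall>j\<in>{..<a}. i \<noteq> j \<longrightarrow> ?f i \<inter> ?f j = {}"
    proof (intro ballI impI)
      fix i j :: nat assume "i \<noteq> j"
      \<comment> \<open>A nonempty clique in a copy reveals the number of the copy through its first
        components.\<close>
      then have "Pair i ` S \<noteq> Pair j ` T" if "S \<in> ?C" for S T
        using cliques_nonempty[OF that assms(2)] by blast
      then show "?f i \<inter> ?f j = {}" by blast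
    qed
  qed (simp_all add: assms finite_cliques)
  moreover have "card (?f i) = num_cliques t G" for i
    by (simp add: card_image inj_on_def inj_image_eq_iff num_cliques_eq)
  ultimately show ?thesis
    by (simp add: num_cliques_eq)
qed

lemma num_cliques_copies_complete_graph_ge:
  assumes "t > 0"
  shows "a * (m choose t) + (b choose t)
         \<le> num_cliques t (disjoint_union (copies a (complete_graph m)) (complete_graph b))"
proof -
  have "a * (m choose t) \<le> num_cliques t (copies a (complete_graph m))"
    using num_cliques_copies_ge[of "complete_graph m" t a] assms
    by (simp add: num_cliques_complete_graph) (simp add: complete_graph_def)
  moreover have "num_cliques t (copies a (complete_graph m)) + num_cliques t (complete_graph b)
      \<le> num_cliques t (disjoint_union (copies a (complete_graph m)) (complete_graph b))"
    using assms by (intro num_cliques_disjoint_union_ge) (auto simp: copies_def complete_graph_def)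
  ultimately show ?thesis by (simp add: num_cliques_complete_graph)
qed

section \<open>Degree and size bounds for the theorem\<close>

lemma card_closed_nbhd_le_max_degree:
  assumes "simple_graph G" "v \<in> verts G"
  shows "card (closed_nbhd (verts G) (edges G) v) \<le> max_degree G + 1"
proof -
  have fin: "finite (verts G)" using assms by (simp add: simple_graph_def)
  have "closed_nbhd (verts G) (edges G) v \<subseteq> insert v {w \<in> verts G. {v, w} \<in> edges G}"
    by (auto simp: closed_nbhd_def)
  then have "card (closed_nbhd (verts G) (edges G) v)
      \<le> card (insert v {w \<in> verts G. {v, w} \<in> edges G})"
    using fin by (intro card_mono) auto
  also have "\<dots> \<le> vertex_degree G v + 1"
    using fin by (simp add: vertex_degree_def card_insert_if)
  also have "\<dots> \<le> max_degree G + 1"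
    using fin assms by (simp add: max_degree_def)
  finally show ?thesis .
qed

text \<open>For \<open>r \<ge> 2\<close> one has
  \<open>3 * sqrt 3 \<le> 6 \<le> 2 * (r + 1)\<close>, so the right side is at least
  \<open>r\<close>. Hence the complete graph on \<open>b\<close> vertices is small enough to serve
  as \<open>H\<close>.\<close>

lemma remainder_size_bound:
  assumes "b \<le> r" "r \<ge> 2"
  shows "real b \<le> 2 * real r * (real r + 1) / (3 * sqrt 3)"
proof -
  have "sqrt 3 \<le> 2" by (rule real_le_lsqrt) auto
  then have "real b * (3 * sqrt 3) \<le> real r * 6"
    using assms by (intro mult_mono) auto
  also have "\<dots> \<le> real r * (2 * (real r + 1))"
    using assms by (intro mult_left_mono) auto
  finally show ?thesis by (simp add: field_simps)
qed

theorem mainTheorem1: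
  fixes G :: "'v graph" and n r a b :: nat
  assumes "r > 0" and "n > 0"
    and "simple_graph G" and "num_verts G = n" and "max_degree G \<le> r"
    and "n = a * (r + 1) + b" and "b \<le> r"
  shows "(\<not> (r = 1 \<and> odd n) \<longrightarrow>
           (\<forall>t\<ge>3. \<exists>(a' :: nat) (H :: nat graph).
              simple_graph H
              \<and> real (num_verts H) \<le> 2 * real r * (real r + 1) / (3 * sqrt 3)
              \<and> n = a' * (r + 1) + num_verts H
              \<and> num_cliques t G
                  \<le> num_cliques t (disjoint_union (copies a' (complete_graph (r + 1))) H)))
       \<and> (r \<le> 6 \<longrightarrow>
           num_cliques 3 G
             \<le> num_cliques 3 (disjoint_union (copies a (complete_graph (r + 1)))
                  (complete_graph b)))"
proof -
  have bound: "num_cliques t G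
      \<le> num_cliques t (disjoint_union (copies a (complete_graph (r + 1))) (complete_graph b))"
    if t: "t \<ge> 3" for t
  proof -
    have "card (cliques t (verts G) (edges G)) \<le> a * ((r + 1) choose t) + (b choose t)"
    proof (rule card_cliques_le[OF _ t])
      show "finite (verts G)" using assms(3) by (simp add: simple_graph_def)
      show "card (verts G) = a * (r + 1) + b" using assms(4,6) by (simp add: num_verts_def)
      show "card (closed_nbhd (verts G) (edges G) v) \<le> r + 1" if "v \<in> verts G" for v
        using card_closed_nbhd_le_max_degree[OF assms(3) that] assms(5) by simp
    qed (rule assms(7))
    also have "\<dots> \<le> num_cliques t (disjoint_union (copies a (complete_graph (r + 1))) (complete_graph b))"
      using t by (intro num_cliques_copies_complete_graph_ge) simp
    finally show ?thesis by (simp add: num_cliques_eq)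
  qed
  have "real b \<le> 2 * real r * (real r + 1) / (3 * sqrt 3)" if "\<not> (r = 1 \<and> odd n)"
  proof (cases "r = 1")
    case True
    \<comment> \<open>For \<open>r = 1\<close> the size bound is below \<open>1\<close>, so the
      remainder has to vanish; the parity of \<open>n\<close> ensures this.\<close>
    then have "even n" "b \<le> 1" using that assms(7) by auto
    then have "b = 0" using assms(6) True by (cases b) auto
    then show ?thesis by simp
  next
    case False
    then show ?thesis using assms(1,7) by (intro remainder_size_bound) auto
  qed
  moreover have "simple_graph (complete_graph b)" "num_verts (complete_graph b) = b"
    by (auto simp: simple_graph_def num_verts_def complete_graph_def)
  \<comment> \<open>Both claims follow from \<open>bound\<close>; in the first the witnesses are
    \<open>a' = a\<close> and \<open>H = complete_graph b\<close>.\<close>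
  ultimately show ?thesis using bound assms(6) by (metis order_refl)
qed

end
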